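(* Let $h_1,h_2:\mathbb{R}\to\mathbb{R}$ be continuous piecewise linear functions with $h_i'(x)=\kappa_i^0$ for $x<0$ and $h_i'(x)=\kappa_i^1$ for $x>0$, $i=1,2$, where $(\kappa_1^0,\kappa_2^0)\in\mathcal{A}_4$ and $(\kappa_1^1,\kappa_2^1)\in\mathcal{A}_3$. Then the system $$u_1(x)=h_1(x)-u_1'u_2'-\tfrac{(u_1')^2}{2},\qquad u_2(x)=h_2(x)-u_1'u_2'-\tfrac{(u_2')^2}{2}$$ has infinitely many admissible solutions $u=(u_1,u_2):\mathbb{R}\to\mathbb{R}^2$.
   Context: Sectors: for $k=1,\dots,8$, $\mathcal{A}_k=\{\rho(\cos\theta,\sin\theta)\in\mathbb{R}^2 : \rho>0,\ \theta\in\,](k-1)\pi/4,\ k\pi/4[\,\}$. Admissible solution: a function $u=(u_1,u_2):\mathbb{R}\to\mathbb{R}^2$ is an admissible solution of the displayed system if: (A1) $u$ is absolutely continuous (on bounded intervals) and its derivative $u'$ satisfies the system at a.e. $x\in\mathbb{R}$; (A2) there is a constant $C$ such that $|u(x)|\le C(1+|x|)$ for all $x\in\mathbb{R}$; (A3) at every $y\in\mathbb{R}$ the derivative $u'$ admits right and left limits $u'(y+)$, $u'(y-)$, and at points where $u'$ is discontinuous these limits satisfy at least one of the conditions $u_1'(y+)+u_2'(y+)\le 0$ or $u_1'(y-)+u_2'(y-)\ge 0$. *)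

theory Defs
  imports "HOL-Analysis.Analysis"
begin

definition sector :: "nat \<Rightarrow> (real \<times> real) set" where
  "sector k = {(\<rho> * cos \<theta>, \<rho> * sin \<theta>) | \<rho> \<theta>.
     0 < \<rho> \<and> (real k - 1) * pi / 4 < \<theta> \<and> \<theta> < real k * pi / 4}"

text \<open>The usual epsilon-delta notion for functions; the library's
  \<^const>\<open>absolutely_continuous\<close> is about measures.\<close>

definition abs_continuous_on :: "real \<Rightarrow> real \<Rightarrow> (real \<Rightarrow> 'a::real_normed_vector) \<Rightarrow> bool" where
  "abs_continuous_on a b f \<longleftrightarrow>
     (\<forall>\<epsilon>>0. \<exists>\<delta>>0. \<forall>(n::nat) s t.
        (\<forall>i<n. a \<le> s i \<and> s i \<le> t i \<and> t i \<le> b) \<and>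
        disjoint_family_on (\<lambda>i. {s i<..<t i}) {..<n} \<and>
        (\<Sum>i<n. t i - s i) < \<delta> \<longrightarrow>
        (\<Sum>i<n. norm (f (t i) - f (s i))) < \<epsilon>)"

definition solves_at ::
  "(real \<Rightarrow> real) \<Rightarrow> (real \<Rightarrow> real) \<Rightarrow> (real \<Rightarrow> real \<times> real) \<Rightarrow> real \<Rightarrow> bool" where
  "solves_at h1 h2 u x \<longleftrightarrow>
     (\<exists>p q. (u has_vector_derivative (p, q)) (at x) \<and>
        fst (u x) = h1 x - p * q - p\<^sup>2 / 2 \<and>
        snd (u x) = h2 x - p * q - q\<^sup>2 / 2)"

text \<open>The derivative of an absolutely continuous function exists only almost everywhere, so it is
  treated as a partial function: limits and continuity of it are taken along the set where it
  exists, since \<^const>\<open>vector_derivative\<close> has an unspecified value elsewhere.\<close>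

definition diff_points :: "(real \<Rightarrow> real \<times> real) \<Rightarrow> real set" where
  "diff_points u = {x. u differentiable (at x)}"

abbreviation vderiv :: "(real \<Rightarrow> real \<times> real) \<Rightarrow> real \<Rightarrow> real \<times> real" where
  "vderiv u \<equiv> \<lambda>x. vector_derivative u (at x)"

definition deriv_continuous_at :: "(real \<Rightarrow> real \<times> real) \<Rightarrow> real \<Rightarrow> bool" where
  "deriv_continuous_at u y \<longleftrightarrow>
     y \<in> diff_points u \<and> continuous (at y within diff_points u) (vderiv u)"

definition admissible_solution ::
  "(real \<Rightarrow> real) \<Rightarrow> (real \<Rightarrow> real) \<Rightarrow> (real \<Rightarrow> real \<times> real) \<Rightarrow> bool" where
  "admissible_solution h1 h2 u \<longleftrightarrow>
     (\<forall>a b. abs_continuous_on a b u) \<and>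
     (AE x in lborel. solves_at h1 h2 u x) \<and>
     (\<exists>C. \<forall>x. norm (u x) \<le> C * (1 + \<bar>x\<bar>)) \<and>
     (\<forall>y. \<exists>l r.
        (vderiv u \<longlongrightarrow> l) (at y within (diff_points u \<inter> {..<y})) \<and>
        (vderiv u \<longlongrightarrow> r) (at y within (diff_points u \<inter> {y<..})) \<and>
        (\<not> deriv_continuous_at u y \<longrightarrow> fst r + snd r \<le> 0 \<or> fst l + snd l \<ge> 0))"

end

(* Put p = u1', q = u2', s = p + q, d = q - p, and let sigma, delta be the sum and the
   difference of the slopes of h1, h2. Where h1, h2 are affine, differentiating the system gives
     (3 s^2 - d^2)' = 4 (sigma - s),   (s d)' = 2 (delta - d),
   an autonomous planar ODE for (s, d) which is singular only at the origin. For sigma > 0 (sector 3,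
   x > 0) its rest point (sigma, delta) attracts as x increases, and in the strip
   0 < d < 3 delta / 2 there is a Lyapunov function vanishing at the origin. It is negative at
   (0, a) for every small a > 0, so the orbit of (0, a) stays in a compact subset of the strip.
   For x < 0 (sector 4) the reflection x -> -x, (p, q) -> (-q, -p) leads back to the same situation
   and fixes the initial value (0, a). Gluing the two halves yields, for each small a, a solution of
   class C^1 with u'(0) = (-a/2, a/2). *)

theory Submission
  imports Defs "HOL-Real_Asymp.Real_Asymp"
begin

section \<open>Global solutions of Lipschitz differential equations\<close>

text \<open>Against the weight \<open>exp (K * t)\<close>, integration gains a factor
  \<open>1 / K\<close>. This makes the Picard operator below contract once \<open>K\<close> exceeds
  the Lipschitz constant.\<close>

lemma integral_norm_bound_exp:
  fixes g :: "real \<Rightarrow> 'a::banach"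
  assumes "continuous_on {0..x} g" "0 \<le> x" "0 < K" "0 \<le> C"
    and bound: "\<And>t. t \<in> {0..x} \<Longrightarrow> norm (g t) \<le> C * exp (K * t)"
  shows "norm (integral {0..x} g) \<le> C / K * exp (K * x)"
proof -
  have I: "((\<lambda>t. C * exp (K * t)) has_integral C / K * exp (K * x) - C / K * exp (K * 0)) {0..x}"
    using assms by (intro fundamental_theorem_of_calculus)
      (auto intro!: derivative_eq_intros simp: has_real_derivative_iff_has_vector_derivative[symmetric])
  have "norm (integral {0..x} g) \<le> integral {0..x} (\<lambda>t. C * exp (K * t))"
    using assms by (intro integral_norm_bound_integral integrable_continuous_real continuous_intros) auto
  also have "\<dots> = C / K * exp (K * x) - C / K * exp (K * 0)"
    by (rule integral_unique[OF I])
  also have "\<dots> \<le> C / K * exp (K * x)"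
    using assms by simp
  finally show ?thesis .
qed

text \<open>The exponential weight makes the Picard operator a contraction on the whole half line.\<close>

lemma picard_lindeloef_half_line:
  fixes f :: "'a::banach \<Rightarrow> 'a"
  assumes lip: "L-lipschitz_on UNIV f"
  shows "\<exists>y. y 0 = y0 \<and> (\<forall>x\<ge>0. (y has_vector_derivative f (y x)) (at x within {0..}))"
proof -
  \<comment> \<open>Any exponent above \<open>L\<close> serves, since the contraction factor will be
    \<open>L / K\<close>.\<close>
  define K where "K = L + 1"
  have L: "0 \<le> L" "L < K" "0 < K"
    using lipschitz_on_nonneg[OF lip] by (auto simp: K_def)
  \<comment> \<open>The solution is sought as \<open>exp (K * t)\<close> times a bounded continuous
    \<open>v\<close>; \<open>G v\<close> is the right-hand side along that function.\<close>
  define G where "G v t = f (exp (K * t) *\<^sub>R apply_bcontfun v t)" for v :: "real \<Rightarrow>\<^sub>C 'a" and t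
  have G_cont: "continuous_on A (G v)" for A v
    unfolding G_def
    by (rule continuous_on_compose2[OF lipschitz_on_continuous_on[OF lip]])
      (auto intro!: continuous_intros)
  \<comment> \<open>The cut-off \<open>max x 0\<close> extends the integral to negative
    \<open>x\<close> by a constant, so that bounded continuous functions on the whole line can be
    used.\<close>
  define Y where "Y v x = y0 + integral {0..max x 0} (G v)" for v x
  have Y_deriv: "(Y v has_vector_derivative G v x) (at x within {0..})" if "0 \<le> x" for v x
  proof -
    have "((\<lambda>u. y0 + integral {0..u} (G v)) has_vector_derivative G v x) (at x within {0..x+1})"
      using integral_has_vector_derivative[OF G_cont, of x 0 "x + 1" v] that
      by (auto intro!: derivative_eq_intros)
    then have "((\<lambda>u. y0 + integral {0..u} (G v)) has_vector_derivative G v x) (at x within {0..})"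
      using at_within_nhd[of x "{..<x+1}" "{0..x+1}" "{0..}"] by fastforce
    then show ?thesis
      by (rule has_vector_derivative_transform[rotated 2]) (use that in \<open>auto simp: Y_def max_def\<close>)
  qed
  have Y_cont: "continuous_on UNIV (Y v)" for v
  proof -
    have "continuous_on {0..} (Y v)"
      using Y_deriv by (intro continuous_on_vector_derivative) auto
    then have "continuous_on UNIV (\<lambda>x. Y v (max x 0))"
      by (rule continuous_on_compose2) (auto intro!: continuous_intros)
    then show ?thesis
      by (simp add: Y_def cong: if_cong)
  qed
  \<comment> \<open>Serves twice: for \<open>G v\<close> it bounds the weighted Picard image, and
    for \<open>G v - G w\<close> it gives the contraction estimate.\<close>
  have int_bound: "exp (- K * max x 0) * norm (integral {0..max x 0} g) \<le> C / K"
    if "continuous_on {0..max x 0} g" "0 \<le> C" "\<And>t. 0 \<le> t \<Longrightarrow> norm (g t) \<le> C * exp (K * t)"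
    for g :: "real \<Rightarrow> 'a" and C x
    using integral_norm_bound_exp[OF that(1) _ L(3) that(2)] that(3)
    by (simp add: exp_minus field_simps)
  define T where "T v = Bcontfun (\<lambda>x. exp (- K * max x 0) *\<^sub>R Y v x)" for v
  have T: "apply_bcontfun (T v) x = exp (- K * max x 0) *\<^sub>R Y v x" for v x
  proof -
    obtain M where M: "norm (apply_bcontfun v t) \<le> M" for t
      using bounded_apply_bcontfun[of v] by (auto simp: bounded_iff)
    have M0: "0 \<le> M" using M[of 0] norm_ge_zero order_trans by blast
    have G_bound: "norm (G v t) \<le> (norm (f 0) + L * M) * exp (K * t)" if "0 \<le> t" for t
    proof -
      have "norm (G v t) \<le> norm (f 0) + L * (exp (K * t) * norm (apply_bcontfun v t))"
        using lipschitz_onD[OF lip, of "exp (K * t) *\<^sub>R apply_bcontfun v t" 0]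
          norm_triangle_sub[of "G v t" "f 0"]
        by (simp add: G_def dist_norm)
      also have "\<dots> \<le> norm (f 0) * exp (K * t) + L * (exp (K * t) * M)"
        using L M that M0 by (intro add_mono mult_left_mono) (auto simp: mult_le_cancel_left1)
      finally show ?thesis by (simp add: algebra_simps)
    qed
    have "norm (exp (- K * max x 0) *\<^sub>R Y v x) \<le> norm y0 + (norm (f 0) + L * M) / K" for x
    proof -
      have "norm (exp (- K * max x 0) *\<^sub>R Y v x)
          \<le> exp (- K * max x 0) * norm y0 + exp (- K * max x 0) * norm (integral {0..max x 0} (G v))"
        unfolding Y_def by (simp add: norm_triangle_ineq distrib_left[symmetric] del: distrib_left)
      also have "\<dots> \<le> norm y0 + (norm (f 0) + L * M) / K"
        using L M0 by (intro add_mono int_bound G_cont G_bound) (auto intro!: mult_left_le_one_le)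
      finally show ?thesis .
    qed
    then have "(\<lambda>x. exp (- K * max x 0) *\<^sub>R Y v x) \<in> bcontfun"
      using Y_cont by (auto simp: bcontfun_def bounded_iff intro!: continuous_intros)
    then show ?thesis by (simp add: T_def Bcontfun_inverse)
  qed
  have "dist (T v) (T w) \<le> L / K * dist v w" for v w
  proof (rule dist_bound)
    fix x
    have "norm (G v t - G w t) \<le> L * dist v w * exp (K * t)" for t
    proof -
      have "norm (G v t - G w t) \<le> L * (exp (K * t) * dist (apply_bcontfun v t) (apply_bcontfun w t))"
        using lipschitz_onD[OF lip, of "exp (K * t) *\<^sub>R apply_bcontfun v t"
            "exp (K * t) *\<^sub>R apply_bcontfun w t"]
        by (simp add: G_def dist_norm scaleR_diff_right[symmetric])
      also have "\<dots> \<le> L * (exp (K * t) * dist v w)"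
        using L by (intro mult_left_mono dist_bounded) auto
      finally show ?thesis by (simp add: algebra_simps)
    qed
    then have "exp (- K * max x 0) * norm (integral {0..max x 0} (\<lambda>t. G v t - G w t)) \<le> L * dist v w / K"
      using L by (intro int_bound continuous_intros G_cont) auto
    then show "dist (apply_bcontfun (T v) x) (apply_bcontfun (T w) x) \<le> L / K * dist v w"
      by (simp add: T Y_def dist_norm scaleR_diff_right[symmetric] integral_diff
          integrable_continuous_real G_cont)
  qed
  then obtain v where "T v = v"
    using banach_fix_type[of "L / K" T] L by auto
  then have "Y v x = exp (K * x) *\<^sub>R apply_bcontfun v x" if "0 \<le> x" for x
    using T[of v x] that by (simp add: exp_minus)
  then have "Y v 0 = y0 \<and> (\<forall>x\<ge>0. (Y v has_vector_derivative f (Y v x)) (at x within {0..}))"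
    using Y_deriv[of _ v] by (simp add: G_def Y_def)
  then show ?thesis by blast
qed

section \<open>Lipschitz bounds for products and reciprocals\<close>

lemma lipschitz_on_compact_mult:
  fixes f g :: "'a::metric_space \<Rightarrow> real"
  assumes "compact X" "C-lipschitz_on X f" "D-lipschitz_on X g"
  shows "\<exists>B. B-lipschitz_on X (\<lambda>x. f x * g x)"
proof -
  \<comment> \<open>A product inherits the Lipschitz property only if both factors are bounded;
    compactness supplies the bounds.\<close>
  obtain A where A: "\<And>x. x \<in> X \<Longrightarrow> \<bar>f x\<bar> \<le> A"
    using compact_imp_bounded[OF compact_continuous_image[OF lipschitz_on_continuous_on[OF assms(2)] assms(1)]]
    by (auto simp: bounded_iff)
  obtain B where B: "\<And>x. x \<in> X \<Longrightarrow> \<bar>g x\<bar> \<le> B"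
    using compact_imp_bounded[OF compact_continuous_image[OF lipschitz_on_continuous_on[OF assms(3)] assms(1)]]
    by (auto simp: bounded_iff)
  \<comment> \<open>The absolute values are there because on an empty \<open>X\<close> the bounds
    \<open>A\<close> and \<open>B\<close> may be negative.\<close>
  have "(\<bar>A\<bar> * D + C * \<bar>B\<bar>)-lipschitz_on X (\<lambda>x. f x * g x)"
  proof (rule lipschitz_onI)
    fix x y assume xy: "x \<in> X" "y \<in> X"
    have "\<bar>f x * g x - f y * g y\<bar> = \<bar>f x * (g x - g y) + (f x - f y) * g y\<bar>"
      by (simp add: algebra_simps)
    also have "\<dots> \<le> \<bar>f x\<bar> * \<bar>g x - g y\<bar> + \<bar>f x - f y\<bar> * \<bar>g y\<bar>"
      by (metis abs_mult abs_triangle_ineq)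
    also have "\<dots> \<le> \<bar>A\<bar> * (D * dist x y) + (C * dist x y) * \<bar>B\<bar>"
      using A[OF xy(1)] B[OF xy(2)] lipschitz_onD[OF assms(2) xy] lipschitz_onD[OF assms(3) xy]
        lipschitz_on_nonneg[OF assms(2)]
      by (intro add_mono mult_mono) (auto simp: dist_real_def)
    finally show "dist (f x * g x) (f y * g y) \<le> (\<bar>A\<bar> * D + C * \<bar>B\<bar>) * dist x y"
      by (simp add: dist_real_def algebra_simps)
  qed (use lipschitz_on_nonneg[OF assms(2)] lipschitz_on_nonneg[OF assms(3)] in auto)
  then show ?thesis by blast
qed

lemma lipschitz_on_inverse:
  fixes f :: "'a::metric_space \<Rightarrow> real"
  assumes "C-lipschitz_on X f" "0 < m" "\<And>x. x \<in> X \<Longrightarrow> m \<le> f x"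
  shows "(C / m\<^sup>2)-lipschitz_on X (\<lambda>x. inverse (f x))"
proof (rule lipschitz_onI)
  fix x y assume xy: "x \<in> X" "y \<in> X"
  note m = assms(3)[OF xy(1)] assms(3)[OF xy(2)]
  have "\<bar>inverse (f x) - inverse (f y)\<bar> = \<bar>f x - f y\<bar> / (f x * f y)"
    using m \<open>0 < m\<close> by (simp add: inverse_diff_inverse abs_mult divide_inverse mult.commute abs_minus_commute)
  also have "\<dots> \<le> C * dist x y / (m * m)"
    using lipschitz_onD[OF assms(1) xy] m \<open>0 < m\<close> lipschitz_on_nonneg[OF assms(1)]
    by (intro frac_le mult_mono) (auto simp: dist_real_def)
  finally show "dist (inverse (f x)) (inverse (f y)) \<le> C / m\<^sup>2 * dist x y"
    by (simp add: dist_real_def power2_eq_square)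
qed (use lipschitz_on_nonneg[OF assms(1)] in auto)

section \<open>The Lyapunov function\<close>

text \<open>The argument \<open>E\<close> stands for \<open>3 \<delta> - 2 d\<close>. For \<open>\<sigma> = 0\<close> the function \<open>lyap\<close> below is the
  first integral obtained from the linear equation for \<open>s\<^sup>2\<close> as a function of \<open>d\<close>; the terms
  containing \<open>\<sigma>\<close> complete the square in its derivative.\<close>

definition lyap_well :: "real \<Rightarrow> real \<Rightarrow> real \<Rightarrow> real" where
  "lyap_well \<sigma> \<delta> E = 3 * \<delta>\<^sup>2 / (4 * E) + \<delta> * ln E - E / 4 + 3 * \<sigma>\<^sup>2 / 4 * ((\<delta> - E)\<^sup>2 / E ^ 3)"

definition lyap :: "real \<Rightarrow> real \<Rightarrow> real \<Rightarrow> real \<Rightarrow> real" where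
  "lyap \<sigma> \<delta> s d = (s - \<sigma> * d / (3 * \<delta> - 2 * d))\<^sup>2 / (3 * \<delta> - 2 * d)
     + lyap_well \<sigma> \<delta> (3 * \<delta> - 2 * d) - lyap_well \<sigma> \<delta> (3 * \<delta>)"

text \<open>The factors show the shape of the well for \<open>\<delta> > 0\<close>: on
  \<open>0 < E < 3 * \<delta>\<close> it falls until \<open>E = \<delta>\<close>, the rest point
  value \<open>d = \<delta>\<close>, and then rises towards \<open>E = 3 * \<delta>\<close>, which
  is \<open>d = 0\<close>.\<close>

lemma lyap_well_deriv:
  assumes "0 < E"
  shows "(lyap_well \<sigma> \<delta> has_real_derivative
    - (E - \<delta>) * (E - 3 * \<delta>) * (E\<^sup>2 + 3 * \<sigma>\<^sup>2) / (4 * E ^ 4)) (at E)"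
proof -
  have 1: "((\<lambda>E. 3 * \<delta>\<^sup>2 / (4 * E)) has_real_derivative - 3 * \<delta>\<^sup>2 / (4 * E\<^sup>2)) (at E)"
    using assms by (auto intro!: derivative_eq_intros simp: power2_eq_square)
  have 2: "((\<lambda>E. \<delta> * ln E) has_real_derivative \<delta> / E) (at E)"
    using assms by (auto intro!: derivative_eq_intros)
  have 3: "((\<lambda>E. (\<delta> - E)\<^sup>2) has_real_derivative - 2 * (\<delta> - E)) (at E)"
    by (auto intro!: derivative_eq_intros)
  have 4: "((\<lambda>E. E ^ 3) has_real_derivative 3 * E\<^sup>2) (at E)"
    by (auto intro!: derivative_eq_intros)
  have "(- 2 * (\<delta> - E) * E ^ 3 - (\<delta> - E)\<^sup>2 * (3 * E\<^sup>2)) / (E ^ 3 * E ^ 3) = - (\<delta> - E) * (3 * \<delta> - E) / E ^ 4"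
    using assms by (simp add: divide_simps) algebra
  then have 5: "((\<lambda>E. (\<delta> - E)\<^sup>2 / E ^ 3) has_real_derivative - (\<delta> - E) * (3 * \<delta> - E) / E ^ 4) (at E)"
    using DERIV_divide[OF 3 4] assms by simp
  have "- 3 * \<delta>\<^sup>2 / (4 * E\<^sup>2) + \<delta> / E - 1 / 4 + 3 * \<sigma>\<^sup>2 / 4 * (- (\<delta> - E) * (3 * \<delta> - E) / E ^ 4)
      = - (E - \<delta>) * (E - 3 * \<delta>) * (E\<^sup>2 + 3 * \<sigma>\<^sup>2) / (4 * E ^ 4)"
    using assms by (simp add: divide_simps) algebra
  then show ?thesis
    unfolding lyap_well_def
    using DERIV_add[OF DERIV_diff[OF DERIV_add[OF 1 2] DERIV_cdivide[OF DERIV_ident, of 4]] DERIV_cmult[OF 5, of "3 * \<sigma>\<^sup>2 / 4"]]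
    by simp
qed

lemma lyap_well_at_top:
  assumes "0 < \<delta>"
  shows "filterlim (lyap_well \<sigma> \<delta>) at_top (at_right 0)"
proof (rule filterlim_at_top_mono)
  show "filterlim (\<lambda>E. 3 * \<delta>\<^sup>2 / (4 * E) + \<delta> * ln E - E / 4) at_top (at_right 0)"
    using assms by real_asymp
  show "\<forall>\<^sub>F E in at_right 0. 3 * \<delta>\<^sup>2 / (4 * E) + \<delta> * ln E - E / 4 \<le> lyap_well \<sigma> \<delta> E"
    unfolding eventually_at_right_field lyap_well_def by (auto intro!: exI[of _ 1])
qed

text \<open>Every term of the derivative contains the numerator of the derivative of
  \<open>d\<close>, and the remaining factor is a multiple of the same numerator. So a square
  appears, and for positive \<open>\<sigma>\<close> and \<open>d\<close> the function
  \<open>lyap\<close> cannot increase along orbits.\<close>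

lemma lyap_deriv:
  assumes s: "(s has_real_derivative 2 * (\<sigma> * s x + \<delta> * d x - (s x)\<^sup>2 - (d x)\<^sup>2) / (3 * (s x)\<^sup>2 + (d x)\<^sup>2)) (at x)"
    and d: "(d has_real_derivative 2 * ((3 * \<delta> - 2 * d x) * s x - \<sigma> * d x) / (3 * (s x)\<^sup>2 + (d x)\<^sup>2)) (at x)"
    and "0 < d x" "2 * d x < 3 * \<delta>"
  shows "((\<lambda>x. lyap \<sigma> \<delta> (s x) (d x)) has_real_derivative
    - 16 * \<sigma> * d x * ((3 * \<delta> - 2 * d x) * s x - \<sigma> * d x)\<^sup>2
      / ((3 * \<delta> - 2 * d x) ^ 4 * (3 * (s x)\<^sup>2 + (d x)\<^sup>2))) (at x)"
proof -
  define E N where "E = 3 * \<delta> - 2 * d x" and "N = 3 * (s x)\<^sup>2 + (d x)\<^sup>2"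
  have pos: "0 < E" "0 < N"
    using assms by (auto simp: E_def N_def add_nonneg_pos)
  define s' d' where "s' = 2 * (\<sigma> * s x + \<delta> * d x - (s x)\<^sup>2 - (d x)\<^sup>2) / N" and "d' = 2 * (E * s x - \<sigma> * d x) / N"
  have sd: "(s has_real_derivative s') (at x)" "(d has_real_derivative d') (at x)"
    using s d by (simp_all add: s'_def d'_def N_def E_def)
  have well: "((\<lambda>x. lyap_well \<sigma> \<delta> (3 * \<delta> - 2 * d x)) has_real_derivative
      - (E - \<delta>) * (E - 3 * \<delta>) * (E\<^sup>2 + 3 * \<sigma>\<^sup>2) / (4 * E ^ 4) * (- 2 * d')) (at x)"
    using lyap_well_deriv[OF pos(1), of \<sigma> \<delta>] unfolding E_def
    by (rule DERIV_chain2) (auto intro!: derivative_eq_intros sd)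
  have den: "((\<lambda>x. 3 * \<delta> - 2 * d x) has_real_derivative - 2 * d') (at x)"
    by (auto intro!: derivative_eq_intros sd)
  have "(\<sigma> * d' * E - \<sigma> * d x * (- 2 * d')) / (E * E) = 3 * \<delta> * \<sigma> * d' / E\<^sup>2"
    by (simp add: E_def power2_eq_square algebra_simps)
  then have quot: "((\<lambda>x. \<sigma> * d x / (3 * \<delta> - 2 * d x)) has_real_derivative 3 * \<delta> * \<sigma> * d' / E\<^sup>2) (at x)"
    using DERIV_divide[OF DERIV_cmult[OF sd(2), of \<sigma>] den] pos(1) by (simp add: E_def)
  have sq: "((\<lambda>x. (f x)\<^sup>2) has_real_derivative 2 * f x * D) (at x)" if "(f has_real_derivative D) (at x)" for f D
    using that by (auto intro!: derivative_eq_intros)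
  have num: "((\<lambda>x. (s x - \<sigma> * d x / (3 * \<delta> - 2 * d x))\<^sup>2) has_real_derivative
      2 * (s x - \<sigma> * d x / E) * (s' - 3 * \<delta> * \<sigma> * d' / E\<^sup>2)) (at x)"
    using sq[OF DERIV_diff[OF sd(1) quot]] unfolding E_def .
  have "((\<lambda>x. lyap \<sigma> \<delta> (s x) (d x)) has_real_derivative
      (2 * (s x - \<sigma> * d x / E) * (s' - 3 * \<delta> * \<sigma> * d' / E\<^sup>2) * E - (s x - \<sigma> * d x / E)\<^sup>2 * (- 2 * d')) / (E * E)
      + - (E - \<delta>) * (E - 3 * \<delta>) * (E\<^sup>2 + 3 * \<sigma>\<^sup>2) / (4 * E ^ 4) * (- 2 * d') - 0) (at x)"
    unfolding lyap_def E_def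
    by (intro DERIV_add DERIV_diff DERIV_divide DERIV_const num[unfolded E_def] den well[unfolded E_def])
      (use pos in \<open>simp add: E_def\<close>)
  also have "(2 * (s x - \<sigma> * d x / E) * (s' - 3 * \<delta> * \<sigma> * d' / E\<^sup>2) * E - (s x - \<sigma> * d x / E)\<^sup>2 * (- 2 * d')) / (E * E)
      + - (E - \<delta>) * (E - 3 * \<delta>) * (E\<^sup>2 + 3 * \<sigma>\<^sup>2) / (4 * E ^ 4) * (- 2 * d') - 0
      = - 16 * \<sigma> * d x * (E * s x - \<sigma> * d x)\<^sup>2 / (E ^ 4 * N)"
  proof -
    \<comment> \<open>Up to the factor \<open>2 / N\<close>, \<open>A\<close> and \<open>W\<close>
      are the derivatives of \<open>s\<close> and \<open>d\<close>; \<open>Q\<close> is the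
      numerator from \<open>lyap_well_deriv\<close>.\<close>
    define A W Q where "A = \<sigma> * s x + \<delta> * d x - (s x)\<^sup>2 - (d x)\<^sup>2" and "W = E * s x - \<sigma> * d x"
      and "Q = (E - \<delta>) * (E - 3 * \<delta>) * (E\<^sup>2 + 3 * \<sigma>\<^sup>2)"
    have W: "s x - \<sigma> * d x / E = W / E"
      using pos by (simp add: W_def field_simps)
    have s': "s' = 2 * A / N" and d': "d' = 2 * W / N"
      by (simp_all add: s'_def d'_def A_def W_def)
    \<comment> \<open>The identity behind the choice of \<open>lyap\<close>: the shift
      \<open>\<sigma> * d / E\<close> and the \<open>\<sigma>\<close> part of the well are fitted so
      that only a multiple of \<open>W\<close> survives.\<close>
    have poly: "4 * (A * E\<^sup>2 - 3 * \<delta> * \<sigma> * W) + 4 * W\<^sup>2 + Q = - 16 * \<sigma> * d x * W"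
      unfolding A_def W_def Q_def E_def by algebra
    have frac: "(2 * (W / E) * (2 * A / N - 3 * \<delta> * \<sigma> * (2 * W / N) / E\<^sup>2) * E - (W / E)\<^sup>2 * (- 2 * (2 * W / N))) / (E * E)
          + - Q / (4 * E ^ 4) * (- 2 * (2 * W / N)) - 0
        = W * (4 * (A * E\<^sup>2 - 3 * \<delta> * \<sigma> * W) + 4 * W\<^sup>2 + Q) / (E ^ 4 * N)"
      using pos by (simp add: divide_simps) algebra
    have Q: "- (E - \<delta>) * (E - 3 * \<delta>) * (E\<^sup>2 + 3 * \<sigma>\<^sup>2) = - Q"
      by (simp only: Q_def mult_minus_left)
    show ?thesis
      unfolding W W_def[symmetric] s' d' Q frac poly by (simp add: power2_eq_square)
  qed
  finally show ?thesis
    by (simp add: E_def N_def)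
qed

text \<open>\<open>lyap\<close> vanishes at the origin, and on the axis \<open>s = 0\<close> its
  derivative for small \<open>d > 0\<close> has the sign of \<open>4 * \<sigma>^2 * d - (\<delta> -
  d) * (3 * \<delta> - 2 * d)^2\<close>, which tends to \<open>- 9 * \<delta>^3\<close> at the
  origin. Starting points near the origin thus lie below the level of the singular point.\<close>

lemma lyap_axis_neg:
  assumes "0 < \<delta>"
  shows "\<exists>a0>0. a0 < \<delta> \<and> (\<forall>a. 0 < a \<and> a < a0 \<longrightarrow> lyap \<sigma> \<delta> 0 a < 0)"
proof (intro exI conjI allI impI)
  \<comment> \<open>Below \<open>\<delta> / 2\<close>, the product
    \<open>(\<delta> - d) * (3 * \<delta> - 2 * d)^2\<close> is at least
    \<open>2 * \<delta>^3\<close>; the second bound keeps \<open>4 * \<sigma>^2 * d\<close> under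
    that value. Adding \<open>1\<close> keeps the denominator positive for
    \<open>\<sigma> = 0\<close>.\<close>
  define a0 where "a0 = min (\<delta> / 2) (\<delta> ^ 3 / (2 * (\<sigma>\<^sup>2 + 1)))"
  have \<sigma>: "0 < \<sigma>\<^sup>2 + 1" by (simp add: add_nonneg_pos)
  show "0 < a0" "a0 < \<delta>"
    using assms \<sigma> by (auto simp: a0_def)
  fix a assume a: "0 < a \<and> a < a0"
  let ?l = "\<lambda>d. 2 * d / (3 * \<delta> - 2 * d) ^ 4 * (4 * \<sigma>\<^sup>2 * d - (\<delta> - d) * (3 * \<delta> - 2 * d)\<^sup>2)"
  have deriv: "(lyap \<sigma> \<delta> 0 has_real_derivative ?l d) (at d)" if "0 \<le> d" "d \<le> a" for d
  proof -
    define E where "E = 3 * \<delta> - 2 * d"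
    have E: "0 < E"
      using that a assms by (auto simp: E_def a0_def)
    have well: "((\<lambda>d. lyap_well \<sigma> \<delta> (3 * \<delta> - 2 * d)) has_real_derivative
      - (E - \<delta>) * (E - 3 * \<delta>) * (E\<^sup>2 + 3 * \<sigma>\<^sup>2) / (4 * E ^ 4) * (- 2)) (at d)"
      using lyap_well_deriv[OF E, of \<sigma> \<delta>] unfolding E_def
      by (rule DERIV_chain2) (auto intro!: derivative_eq_intros)
    have den: "((\<lambda>d. (3 * \<delta> - 2 * d) ^ 3) has_real_derivative - 6 * E\<^sup>2) (at d)"
      unfolding E_def by (auto intro!: derivative_eq_intros)
    have num: "((\<lambda>d. (\<sigma> * d)\<^sup>2) has_real_derivative 2 * \<sigma>\<^sup>2 * d) (at d)"
      by (auto intro!: derivative_eq_intros simp: power2_eq_square)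
    have "lyap \<sigma> \<delta> 0 = (\<lambda>d. (\<sigma> * d)\<^sup>2 / (3 * \<delta> - 2 * d) ^ 3
        + lyap_well \<sigma> \<delta> (3 * \<delta> - 2 * d) - lyap_well \<sigma> \<delta> (3 * \<delta>))"
      by (simp add: lyap_def fun_eq_iff power_divide power_numeral_reduce)
    moreover have "(2 * \<sigma>\<^sup>2 * d * E ^ 3 - (\<sigma> * d)\<^sup>2 * (- 6 * E\<^sup>2)) / (E ^ 3 * E ^ 3)
        = 2 * \<sigma>\<^sup>2 * d / E ^ 3 + 6 * \<sigma>\<^sup>2 * d\<^sup>2 / E ^ 4"
      using E by (simp add: divide_simps) algebra
    ultimately have "(lyap \<sigma> \<delta> 0 has_real_derivative
       2 * \<sigma>\<^sup>2 * d / E ^ 3 + 6 * \<sigma>\<^sup>2 * d\<^sup>2 / E ^ 4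
      + - (E - \<delta>) * (E - 3 * \<delta>) * (E\<^sup>2 + 3 * \<sigma>\<^sup>2) / (4 * E ^ 4) * (- 2)) (at d)"
      using DERIV_diff[OF DERIV_add[OF DERIV_divide[OF num den] well] DERIV_const] E
      by (simp add: E_def)
    also have "2 * \<sigma>\<^sup>2 * d / E ^ 3 + 6 * \<sigma>\<^sup>2 * d\<^sup>2 / E ^ 4
      + - (E - \<delta>) * (E - 3 * \<delta>) * (E\<^sup>2 + 3 * \<sigma>\<^sup>2) / (4 * E ^ 4) * (- 2) = ?l d"
    proof -
      have "4 * (2 * \<sigma>\<^sup>2 * d * E + 6 * \<sigma>\<^sup>2 * d\<^sup>2) + 2 * ((E - \<delta>) * (E - 3 * \<delta>) * (E\<^sup>2 + 3 * \<sigma>\<^sup>2))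
          = 8 * d * (4 * \<sigma>\<^sup>2 * d - (\<delta> - d) * E\<^sup>2)"
        unfolding E_def by algebra
      moreover have "2 * \<sigma>\<^sup>2 * d / E ^ 3 + 6 * \<sigma>\<^sup>2 * d\<^sup>2 / E ^ 4 + - Q / (4 * E ^ 4) * (- 2)
          = (4 * (2 * \<sigma>\<^sup>2 * d * E + 6 * \<sigma>\<^sup>2 * d\<^sup>2) + 2 * Q) / (4 * E ^ 4)" for Q
        using E by (simp add: divide_simps) algebra
      moreover have "8 * d * Z / (4 * E ^ 4) = 2 * d / E ^ 4 * Z" for Z
        by simp
      ultimately show ?thesis
        unfolding E_def[symmetric] by (simp only: mult_minus_left)
    qed
    finally show ?thesis .
  qed
  have neg: "?l d < 0" if "0 < d" "d < a" for d
  proof -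
    have d: "d < \<delta> / 2" "d * (\<sigma>\<^sup>2 + 1) * 2 < \<delta> ^ 3"
      using that a \<sigma> less_trans[of d a "\<delta> ^ 3 / (2 * (\<sigma>\<^sup>2 + 1))"]
      by (auto simp: a0_def pos_less_divide_eq mult_ac)
    have "4 * \<sigma>\<^sup>2 * d \<le> 2 * (d * (\<sigma>\<^sup>2 + 1) * 2)"
      using that by (simp add: algebra_simps)
    also have "\<dots> < 2 * \<delta> ^ 3" using d by simp
    also have "\<dots> = \<delta> / 2 * (2 * \<delta>)\<^sup>2" by (simp add: power_numeral_reduce)
    also have "\<dots> \<le> (\<delta> - d) * (3 * \<delta> - 2 * d)\<^sup>2"
      using d that by (intro mult_mono power_mono) auto
    finally show ?thesis
      using that d by (intro mult_pos_neg divide_pos_pos) auto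
  qed
  \<comment> \<open>The derivative is zero at \<open>0\<close> itself, so its sign is used on the
    open interval only, together with continuity on the closed one.\<close>
  have "lyap \<sigma> \<delta> 0 a < lyap \<sigma> \<delta> 0 0"
  proof (rule DERIV_neg_imp_decreasing_open[where f = "lyap \<sigma> \<delta> 0"])
    show "\<And>x. 0 < x \<Longrightarrow> x < a \<Longrightarrow> \<exists>y. (lyap \<sigma> \<delta> 0 has_real_derivative y) (at x) \<and> y < 0"
      using deriv neg less_imp_le by blast
    show "continuous_on {0..a} (lyap \<sigma> \<delta> 0)"
      by (rule DERIV_continuous_on, rule DERIV_subset[OF deriv]) auto
  qed (use a in simp)
  then show "lyap \<sigma> \<delta> 0 a < 0" by (simp add: lyap_def)
qed

section \<open>Orbits trapped by the Lyapunov function\<close>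

text \<open>Cramer's rule for the linear system \<open>6 s s' - 2 d d' = 4 (\<sigma> - s)\<close>,
  \<open>d s' + s d' = 2 (\<delta> - d)\<close>, whose determinant is
  \<open>2 (3 s^2 + d^2)\<close>.\<close>

definition slope_field :: "real \<Rightarrow> real \<Rightarrow> real \<times> real \<Rightarrow> real \<times> real" where
  "slope_field \<sigma> \<delta> = (\<lambda>(s, d).
     (2 * (\<sigma> * s + \<delta> * d - s\<^sup>2 - d\<^sup>2) / (3 * s\<^sup>2 + d\<^sup>2),
      2 * ((3 * \<delta> - 2 * d) * s - \<sigma> * d) / (3 * s\<^sup>2 + d\<^sup>2)))"

text \<open>The field is built from the coordinates by sums, products and one reciprocal; the bound
  \<open>m\<close> keeps \<open>X\<close> away from the singular origin, where that reciprocal blows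
  up.\<close>

lemma slope_field_lipschitz:
  assumes X: "compact X" and m: "0 < m" "\<And>s d. (s, d) \<in> X \<Longrightarrow> m \<le> 3 * s\<^sup>2 + d\<^sup>2"
  shows "\<exists>C. C-lipschitz_on X (slope_field \<sigma> \<delta>)"
proof -
  let ?Lip = "\<lambda>f :: real \<times> real \<Rightarrow> real. \<exists>C. C-lipschitz_on X f"
  have lip_fst: "?Lip fst" and lip_snd: "?Lip snd"
    by (intro exI[of _ 1] lipschitz_onI; simp add: dist_fst_le dist_snd_le)+
  have lip_const: "?Lip (\<lambda>_. c)" for c
    using lipschitz_on_constant by blast
  have lip_add: "?Lip (\<lambda>z. f z + g z)" and lip_diff: "?Lip (\<lambda>z. f z - g z)"
    and lip_mult: "?Lip (\<lambda>z. f z * g z)" if "?Lip f" "?Lip g" for f g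
    using that lipschitz_on_add lipschitz_on_diff lipschitz_on_compact_mult[OF X] by blast+
  have lip_den: "?Lip (\<lambda>z. inverse (3 * (fst z * fst z) + snd z * snd z))"
  proof -
    obtain C where "C-lipschitz_on X (\<lambda>z. 3 * (fst z * fst z) + snd z * snd z)"
      using lip_add[OF lip_mult[OF lip_const[of 3] lip_mult[OF lip_fst lip_fst]] lip_mult[OF lip_snd lip_snd]]
      by blast
    from lipschitz_on_inverse[OF this m(1)] show ?thesis
      using m(2) by (fastforce simp: power2_eq_square)
  qed
  have "?Lip (\<lambda>z. (2 * (\<sigma> * fst z + \<delta> * snd z - fst z * fst z - snd z * snd z))
      * inverse (3 * (fst z * fst z) + snd z * snd z))"
    "?Lip (\<lambda>z. (2 * ((3 * \<delta> - 2 * snd z) * fst z - \<sigma> * snd z))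
      * inverse (3 * (fst z * fst z) + snd z * snd z))"
    by (intro lip_mult lip_add lip_diff lip_const lip_fst lip_snd lip_den)+
  then obtain C D where "C-lipschitz_on X (\<lambda>z. fst (slope_field \<sigma> \<delta> z))"
      "D-lipschitz_on X (\<lambda>z. snd (slope_field \<sigma> \<delta> z))"
    by (auto simp: slope_field_def case_prod_beta divide_inverse power2_eq_square)
  from lipschitz_on_Pair[OF this] show ?thesis
    by auto
qed

text \<open>For fixed \<open>d\<close>, the minimum of \<open>lyap\<close> over \<open>s\<close>
  exceeds the negative level \<open>c\<close> both near \<open>d = 0\<close>, where it tends to
  \<open>0\<close>, and near \<open>d = 3 * \<delta> / 2\<close>, where it tends to infinity. A
  sublevel set between two such values of \<open>d\<close> therefore misses both edges, and there
  the square term bounds \<open>s\<close>.\<close>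

lemma lyap_sublevel_box:
  assumes "0 < \<delta>" "0 < a" "a < \<delta>" "c < 0"
  shows "\<exists>d0 d1 S. 0 < d0 \<and> d0 < a \<and> a < d1 \<and> 2 * d1 < 3 * \<delta> \<and> 0 < S
    \<and> (\<forall>s d. d0 \<le> d \<and> d \<le> d1 \<and> lyap \<sigma> \<delta> s d \<le> c \<longrightarrow> d0 < d \<and> d < d1 \<and> \<bar>s\<bar> < S)"
proof -
  \<comment> \<open>The minimum over \<open>s\<close>, attained where the square in
    \<open>lyap\<close> vanishes.\<close>
  define g where "g d = lyap_well \<sigma> \<delta> (3 * \<delta> - 2 * d) - lyap_well \<sigma> \<delta> (3 * \<delta>)" for d
  have lyap: "lyap \<sigma> \<delta> s d = (s - \<sigma> * d / (3 * \<delta> - 2 * d))\<^sup>2 / (3 * \<delta> - 2 * d) + g d" for s d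
    by (simp add: lyap_def g_def)
  have g_cont: "isCont g d" if "2 * d < 3 * \<delta>" for d
    unfolding g_def
    by (intro continuous_intros isCont_o2[of d _ "lyap_well \<sigma> \<delta>"])
      (use DERIV_isCont[OF lyap_well_deriv[of "3 * \<delta> - 2 * d" \<sigma> \<delta>]] that in auto)
  obtain d0 where d0: "0 < d0" "d0 < a" "c < g d0"
  proof -
    have "(g \<longlongrightarrow> g 0) (at_right 0)"
      using g_cont[of 0] assms(1) by (simp add: isCont_def filterlim_at_split)
    moreover have "c < g 0"
      using assms by (simp add: g_def)
    ultimately have "\<forall>\<^sub>F d in at_right 0. c < g d"
      by (rule order_tendstoD)
    then show ?thesis
      using that eventually_conj[OF _ eventually_at_right_real[OF assms(2)]]
      by (metis (mono_tags, lifting) eventually_happens' greaterThanLessThan_iff trivial_limit_at_right_real)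
  qed
  \<comment> \<open>\<open>d1\<close> is \<open>(3 * \<delta> - E) / 2\<close> for a small
    \<open>E\<close>; choosing \<open>E < \<delta>\<close> gives
    \<open>d1 > \<delta> > a\<close>.\<close>
  obtain d1 where d1: "a < d1" "2 * d1 < 3 * \<delta>" "c < g d1"
  proof -
    have "\<forall>\<^sub>F E in at_right 0. c + lyap_well \<sigma> \<delta> (3 * \<delta>) < lyap_well \<sigma> \<delta> E"
      using lyap_well_at_top[OF assms(1)] by (auto simp: filterlim_at_top_dense)
    from eventually_conj[OF this eventually_at_right_real[OF assms(1)]]
    obtain E where "c + lyap_well \<sigma> \<delta> (3 * \<delta>) < lyap_well \<sigma> \<delta> E" "0 < E" "E < \<delta>"
      by (metis (mono_tags, lifting) eventually_happens' greaterThanLessThan_iff trivial_limit_at_right_real)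
    then show ?thesis
      using that[of "(3 * \<delta> - E) / 2"] assms by (simp add: g_def diff_divide_distrib)
  qed
  have "compact (g ` {d0..d1})"
    using d1 g_cont by (intro compact_continuous_image continuous_at_imp_continuous_on) auto
  then obtain m where m: "\<And>d. d0 \<le> d \<Longrightarrow> d \<le> d1 \<Longrightarrow> m \<le> g d"
    by (metis atLeastAtMost_iff bdd_below.E bounded_imp_bdd_below compact_imp_bounded imageI)
  have "compact ((\<lambda>d. \<sigma> * d / (3 * \<delta> - 2 * d)) ` {d0..d1})"
    using d1 by (intro compact_continuous_image continuous_intros) auto
  then obtain B where B: "\<And>d. d0 \<le> d \<Longrightarrow> d \<le> d1 \<Longrightarrow> \<bar>\<sigma> * d / (3 * \<delta> - 2 * d)\<bar> \<le> B"
    by (metis (no_types, lifting) atLeastAtMost_iff bounded_iff compact_imp_bounded imageI real_norm_def)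
  \<comment> \<open>\<open>B\<close> bounds the centre of the square, the root bounds the distance
    of \<open>s\<close> from it, and \<open>1\<close> makes the estimate strict.\<close>
  define S where "S = \<bar>B\<bar> + sqrt (3 * \<delta> * \<bar>c - m\<bar>) + 1"
  have "d0 < d \<and> d < d1 \<and> \<bar>s\<bar> < S" if H: "d0 \<le> d \<and> d \<le> d1 \<and> lyap \<sigma> \<delta> s d \<le> c" for s d
  proof -
    have E: "0 < 3 * \<delta> - 2 * d" using H d1 by simp
    have sq: "(s - \<sigma> * d / (3 * \<delta> - 2 * d))\<^sup>2 / (3 * \<delta> - 2 * d) \<le> c - g d"
      using H by (simp add: lyap)
    moreover have "0 \<le> (s - \<sigma> * d / (3 * \<delta> - 2 * d))\<^sup>2 / (3 * \<delta> - 2 * d)"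
      using E by simp
    ultimately have "g d \<le> c" by linarith
    then have "d \<noteq> d0" "d \<noteq> d1" using d0 d1 by auto
    moreover have "\<bar>s\<bar> < S"
    proof -
      have "(s - \<sigma> * d / (3 * \<delta> - 2 * d))\<^sup>2 \<le> (3 * \<delta> - 2 * d) * (c - g d)"
        using sq E by (simp add: pos_divide_le_eq mult.commute)
      also have "\<dots> \<le> 3 * \<delta> * \<bar>c - m\<bar>"
        using E H d0 m[of d] \<open>g d \<le> c\<close> by (intro mult_mono) auto
      finally have "\<bar>s - \<sigma> * d / (3 * \<delta> - 2 * d)\<bar> \<le> sqrt (3 * \<delta> * \<bar>c - m\<bar>)"
        using real_sqrt_le_mono real_sqrt_abs by metis
      moreover have "\<bar>s\<bar> \<le> \<bar>s - r\<bar> + \<bar>r\<bar>" for r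
        by simp
      ultimately have "\<bar>s\<bar> \<le> sqrt (3 * \<delta> * \<bar>c - m\<bar>) + B"
        using B[of d] H by (meson add_mono order_trans)
      then show ?thesis
        by (simp add: S_def)
    qed
    ultimately show ?thesis using H by simp
  qed
  moreover have "0 < S"
    using assms by (simp add: S_def add_nonneg_pos)
  ultimately show ?thesis
    using d0 d1 by blast
qed

text \<open>Composing the field with the projection onto a box makes it globally Lipschitz, so a
  solution exists for all \<open>x \<ge> 0\<close>. The Lyapunov function then confines this
  solution to the box, where the projection changes nothing.\<close>

lemma slope_field_trapped_solution:
  assumes "0 < \<sigma>" "0 < \<delta>" "0 < a" "a < \<delta>" "lyap \<sigma> \<delta> 0 a < 0"
  shows "\<exists>y. y 0 = (0, a) \<and> bounded (y ` {0..}) \<and> (\<forall>x\<ge>0. 0 < snd (y x) \<and>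
    (y has_vector_derivative slope_field \<sigma> \<delta> (y x)) (at x within {0..}))"
proof -
  define c where "c = lyap \<sigma> \<delta> 0 a"
  obtain d0 d1 S where box: "0 < d0" "d0 < a" "a < d1" "2 * d1 < 3 * \<delta>" "0 < S"
    and trap: "\<And>s d. d0 \<le> d \<Longrightarrow> d \<le> d1 \<Longrightarrow> lyap \<sigma> \<delta> s d \<le> c \<Longrightarrow> d0 < d \<and> d < d1 \<and> \<bar>s\<bar> < S"
    using lyap_sublevel_box[of \<delta> a c \<sigma>] assms unfolding c_def by blast
  let ?lo = "(- S, d0)" and ?hi = "(S, d1)"
  have in_cbox: "z \<in> cbox ?lo ?hi \<longleftrightarrow> - S \<le> fst z \<and> fst z \<le> S \<and> d0 \<le> snd z \<and> snd z \<le> d1" for z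
    by (cases z) (auto simp: cbox_Pair_eq)
  have in_box: "z \<in> box ?lo ?hi \<longleftrightarrow> - S < fst z \<and> fst z < S \<and> d0 < snd z \<and> snd z < d1" for z
    by (cases z) (auto simp: mem_box Basis_prod_def)
  define F where "F = slope_field \<sigma> \<delta> \<circ> clamp ?lo ?hi"
  have F: "F z = slope_field \<sigma> \<delta> z" if "z \<in> cbox ?lo ?hi" for z
    using that by (simp add: F_def)
  have "\<exists>C. C-lipschitz_on (cbox ?lo ?hi) (slope_field \<sigma> \<delta>)"
  proof (rule slope_field_lipschitz)
    show "d0\<^sup>2 \<le> 3 * s\<^sup>2 + d\<^sup>2" if "(s, d) \<in> cbox ?lo ?hi" for s d
      using that box power_mono[of d0 d 2] by (simp add: in_cbox add_increasing)
  qed (use box in auto)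
  then obtain C where C: "C-lipschitz_on (cbox ?lo ?hi) (slope_field \<sigma> \<delta>)" by blast
  have "1-lipschitz_on UNIV (clamp ?lo ?hi)"
    by (intro lipschitz_onI) (auto simp: dist_clamps_le_dist_args)
  moreover have "range (clamp ?lo ?hi) \<subseteq> cbox ?lo ?hi"
    by (intro image_subsetI clamp_in_interval) (use box in \<open>auto simp: Basis_prod_def\<close>)
  ultimately have "(C * 1)-lipschitz_on UNIV F"
    unfolding F_def using lipschitz_on_subset[OF C] by (intro lipschitz_on_compose)
  from picard_lindeloef_half_line[OF this, of "(0, a)"]
  obtain y where y0: "y 0 = (0, a)"
    and y: "\<And>x. 0 \<le> x \<Longrightarrow> (y has_vector_derivative F (y x)) (at x within {0..})" by blast
  have y_cont: "continuous_on {0..} y"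
    using y by (intro continuous_on_vector_derivative) auto
  have stays: "y x \<in> box ?lo ?hi" if "0 \<le> x" for x
  proof (rule ccontr)
    assume out: "y x \<notin> box ?lo ?hi"
    \<comment> \<open>\<open>B\<close> collects the times spent outside the open box. It is closed,
      so its infimum \<open>T\<close> is a first exit time.\<close>
    define B where "B = {0..} \<inter> y -` (- box ?lo ?hi)"
    have B: "closed B" "bdd_below B" "B \<noteq> {}"
      using out that continuous_closed_preimage[OF y_cont, of "- box ?lo ?hi"]
      by (auto simp: B_def closed_Compl open_box intro: bdd_belowI[of _ 0])
    define T where "T = Inf B"
    have "T \<in> B" unfolding T_def using B by (intro closed_contains_Inf)
    then have T: "0 \<le> T" "y T \<notin> box ?lo ?hi" by (auto simp: B_def)
    have before: "y t \<in> box ?lo ?hi" if "0 \<le> t" "t < T" for t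
      using that cInf_lower[OF _ B(2), of t] by (auto simp: B_def T_def)
    have "0 < T" using T y0 box by (cases "T = 0") (auto simp: in_box)
    \<comment> \<open>At \<open>T\<close> itself the orbit is a limit of points of the open box,
      hence in the closed box. So the unmodified equation holds up to \<open>T\<close>.\<close>
    have in_c: "y t \<in> cbox ?lo ?hi" if "t \<in> {0..T}" for t
    proof -
      have "continuous_on (closure {0..<T}) y"
        using \<open>0 < T\<close> y_cont by (auto intro: continuous_on_subset)
      then have "y ` closure {0..<T} \<subseteq> closure (y ` {0..<T})"
        by (intro image_closure_subset closure_subset closed_closure)
      also have "\<dots> \<subseteq> cbox ?lo ?hi"
        by (intro closure_minimal closed_cbox image_subsetI subsetD[OF box_subset_cbox] before) auto
      finally show ?thesis using that \<open>0 < T\<close> by auto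
    qed
    have "lyap \<sigma> \<delta> (fst (y T)) (snd (y T)) \<le> lyap \<sigma> \<delta> (fst (y 0)) (snd (y 0))"
    proof (rule DERIV_nonpos_imp_decreasing_open[where f = "\<lambda>x. lyap \<sigma> \<delta> (fst (y x)) (snd (y x))"])
      fix t assume t: "0 < t" "t < T"
      have "(y has_vector_derivative slope_field \<sigma> \<delta> (y t)) (at t)"
        using y[of t] F[OF in_c[of t]] t at_within_interior[of t "{0..}"] by simp
      then have d: "((\<lambda>x. fst (y x)) has_real_derivative fst (slope_field \<sigma> \<delta> (y t))) (at t)"
        "((\<lambda>x. snd (y x)) has_real_derivative snd (slope_field \<sigma> \<delta> (y t))) (at t)"
        unfolding has_real_derivative_iff_has_vector_derivative
        by (auto intro: bounded_linear.has_vector_derivative[OF bounded_linear_fst]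
          bounded_linear.has_vector_derivative[OF bounded_linear_snd])
      have "0 < snd (y t)" "2 * snd (y t) < 3 * \<delta>"
        using in_c[of t] t box by (auto simp: in_cbox)
      from lyap_deriv[OF d[unfolded slope_field_def case_prod_beta fst_conv snd_conv] this]
      show "\<exists>D. ((\<lambda>x. lyap \<sigma> \<delta> (fst (y x)) (snd (y x))) has_real_derivative D) (at t) \<and> D \<le> 0"
        using \<open>0 < snd (y t)\<close> assms(1) by (intro exI conjI) (auto intro!: divide_nonpos_nonneg)
    next
      have cont: "continuous_on {0..T} y" using y_cont by (rule continuous_on_subset) auto
      have "continuous_on {0<..} (lyap_well \<sigma> \<delta>)"
        by (intro continuous_at_imp_continuous_on) (use lyap_well_deriv DERIV_isCont in blast)
      then have "continuous_on {0..T} (\<lambda>x. lyap_well \<sigma> \<delta> (3 * \<delta> - 2 * snd (y x)))"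
        by (rule continuous_on_compose2)
          (use in_c box in \<open>fastforce simp: in_cbox intro!: continuous_intros cont\<close>)+
      then show "continuous_on {0..T} (\<lambda>x. lyap \<sigma> \<delta> (fst (y x)) (snd (y x)))"
        unfolding lyap_def using in_c box
        by (intro continuous_intros cont) (fastforce simp: in_cbox)+
    qed (use T in simp)
    \<comment> \<open>The value of \<open>lyap\<close> at \<open>T\<close> is still at most
      \<open>c\<close>, so \<open>trap\<close> moves \<open>y T\<close> from the closed box into the
      open one, against the choice of \<open>T\<close>.\<close>
    then have "y T \<in> box ?lo ?hi"
      using in_c[of T] T trap[of "snd (y T)" "fst (y T)"] by (auto simp: in_cbox in_box y0 c_def)
    with T show False by blast
  qed
  have "bounded (y ` {0..})"
    using stays by (intro bounded_subset[OF bounded_box]) auto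
  moreover have "0 < snd (y x) \<and> (y has_vector_derivative slope_field \<sigma> \<delta> (y x)) (at x within {0..})"
    if "0 \<le> x" for x
    using stays[OF that] y[OF that] F[of "y x"] box_subset_cbox[of ?lo ?hi] box(1) by (auto simp: in_box)
  ultimately show ?thesis using y0 by blast
qed

section \<open>Solutions on half lines and their gluing\<close>

text \<open>The derivative conditions say that \<open>u = h - H(p, q)\<close> has \<open>u' = (p, q)\<close> when \<open>h\<close> has slopes
  \<open>\<kappa>1\<close>, \<open>\<kappa>2\<close>, where \<open>H(p, q) = (p q + p\<^sup>2 / 2, p q + q\<^sup>2 / 2)\<close>.\<close>

definition half_line_solution ::
  "real \<Rightarrow> real \<Rightarrow> real \<Rightarrow> (real \<Rightarrow> real) \<Rightarrow> (real \<Rightarrow> real) \<Rightarrow> bool" where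
  "half_line_solution \<kappa>1 \<kappa>2 a p q \<longleftrightarrow> p 0 = - a / 2 \<and> q 0 = a / 2 \<and>
     bounded (p ` {0..}) \<and> bounded (q ` {0..}) \<and> continuous_on {0..} p \<and> continuous_on {0..} q \<and>
     (\<forall>x\<ge>0. ((\<lambda>x. p x * q x + (p x)\<^sup>2 / 2) has_real_derivative \<kappa>1 - p x) (at x within {0..}) \<and>
       ((\<lambda>x. p x * q x + (q x)\<^sup>2 / 2) has_real_derivative \<kappa>2 - q x) (at x within {0..}))"

text \<open>The trapped orbit is translated back by \<open>p = (s - d) / 2\<close> and
  \<open>q = (s + d) / 2\<close>, which sends its start \<open>(0, a)\<close> to
  \<open>(- a / 2, a / 2)\<close>.\<close>

lemma half_line_solution_exists:
  assumes "0 < \<kappa>1 + \<kappa>2" "0 < \<kappa>2 - \<kappa>1"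
  shows "\<exists>a0>0. \<forall>a. 0 < a \<and> a < a0 \<longrightarrow> (\<exists>p q. half_line_solution \<kappa>1 \<kappa>2 a p q)"
proof -
  define \<sigma> \<delta> where "\<sigma> = \<kappa>1 + \<kappa>2" and "\<delta> = \<kappa>2 - \<kappa>1"
  have pos: "0 < \<sigma>" "0 < \<delta>" using assms by (auto simp: \<sigma>_def \<delta>_def)
  obtain a0 where a0: "0 < a0" "a0 < \<delta>" "\<And>a. 0 < a \<Longrightarrow> a < a0 \<Longrightarrow> lyap \<sigma> \<delta> 0 a < 0"
    using lyap_axis_neg[OF pos(2)] by blast
  have "\<exists>p q. half_line_solution \<kappa>1 \<kappa>2 a p q"
    if a: "0 < a" "a < a0" for a
  proof -
    obtain y where y0: "y 0 = (0, a)" and bdd: "bounded (y ` {0..})"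
      and pos_d: "\<And>x. 0 \<le> x \<Longrightarrow> 0 < snd (y x)"
      and y: "\<And>x. 0 \<le> x \<Longrightarrow> (y has_vector_derivative slope_field \<sigma> \<delta> (y x)) (at x within {0..})"
      using slope_field_trapped_solution[OF pos a(1) _ a0(3)[OF a]] a a0 by force
    have y_cont: "continuous_on {0..} y"
      using y by (intro continuous_on_vector_derivative) auto
    define p q where "p x = (fst (y x) - snd (y x)) / 2" and "q x = (fst (y x) + snd (y x)) / 2" for x
    have D: "((\<lambda>x. p x * q x + (p x)\<^sup>2 / 2) has_real_derivative \<kappa>1 - p x) (at x within {0..}) \<and>
      ((\<lambda>x. p x * q x + (q x)\<^sup>2 / 2) has_real_derivative \<kappa>2 - q x) (at x within {0..})" if x: "0 \<le> x" for x
    proof -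
      define s d where "s = fst (y x)" and "d = snd (y x)"
      define N A W where "N = 3 * s\<^sup>2 + d\<^sup>2" and "A = \<sigma> * s + \<delta> * d - s\<^sup>2 - d\<^sup>2"
        and "W = (3 * \<delta> - 2 * d) * s - \<sigma> * d"
      have N: "N \<noteq> 0"
        using pos_d[OF x] zero_le_power2[of s] zero_less_power2[of d] unfolding N_def d_def
        by (smt (verit))
      have field: "slope_field \<sigma> \<delta> (y x) = (2 * A / N, 2 * W / N)"
        by (simp add: slope_field_def case_prod_beta N_def A_def W_def s_def d_def)
      have "((\<lambda>x. fst (y x)) has_real_derivative 2 * A / N) (at x within {0..})"
        "((\<lambda>x. snd (y x)) has_real_derivative 2 * W / N) (at x within {0..})"
        using bounded_linear.has_vector_derivative[OF bounded_linear_fst y[OF x]]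
          bounded_linear.has_vector_derivative[OF bounded_linear_snd y[OF x]]
        unfolding has_real_derivative_iff_has_vector_derivative field by simp_all
      then have pq: "(p has_real_derivative (A - W) / N) (at x within {0..})"
        "(q has_real_derivative (A + W) / N) (at x within {0..})"
        unfolding p_def q_def
        by (auto intro!: derivative_eq_intros simp: diff_divide_distrib add_divide_distrib)
      \<comment> \<open>Collects the terms in the order in which the product rule and the rule for
        \<open>(f x)\<^sup>2 / 2\<close> deliver them.\<close>
      have regroup: "c * q x + e * p x + p x * c = c * (p x + q x) + e * p x"
        "c * q x + e * p x + q x * e = e * (p x + q x) + c * q x" for c e
        by (simp_all add: algebra_simps)
      have "(A - W) / N * (p x + q x) + (A + W) / N * p x = \<kappa>1 - p x"
        "(A + W) / N * (p x + q x) + (A - W) / N * q x = \<kappa>2 - q x"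
      proof -
        have k: "\<kappa>1 = (\<sigma> - \<delta>) / 2" "\<kappa>2 = (\<sigma> + \<delta>) / 2"
          by (simp_all add: \<sigma>_def \<delta>_def)
        \<comment> \<open>With the denominator \<open>N\<close> cleared, this says that
          \<open>slope_field\<close> solves the linear system it was derived from.\<close>
        have "(A - W) * s * 2 + (A + W) * (s - d) = N * ((\<sigma> - \<delta>) - (s - d))"
          "(A + W) * s * 2 + (A - W) * (s + d) = N * ((\<sigma> + \<delta>) - (s + d))"
          unfolding A_def W_def N_def by algebra+
        then show "(A - W) / N * (p x + q x) + (A + W) / N * p x = \<kappa>1 - p x"
          "(A + W) / N * (p x + q x) + (A - W) / N * q x = \<kappa>2 - q x"
          using N unfolding p_def q_def k s_def[symmetric] d_def[symmetric]
          by (simp_all add: divide_simps) algebra+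
      qed
      then have eqs: "(A - W) / N * q x + (A + W) / N * p x + p x * ((A - W) / N) = \<kappa>1 - p x"
        "(A - W) / N * q x + (A + W) / N * p x + q x * ((A + W) / N) = \<kappa>2 - q x"
        by (simp_all only: regroup)
      have half_sq: "((\<lambda>x. (f x)\<^sup>2 / 2) has_real_derivative f x * D) (at x within {0..})"
        if "(f has_real_derivative D) (at x within {0..})" for f D
        using that by (auto intro!: derivative_eq_intros)
      show ?thesis
        using DERIV_add[OF DERIV_mult[OF pq] half_sq[OF pq(1)]]
          DERIV_add[OF DERIV_mult[OF pq] half_sq[OF pq(2)]]
        unfolding eqs by blast
    qed
    obtain M where M: "\<And>x. 0 \<le> x \<Longrightarrow> norm (y x) \<le> M"
      using bdd by (auto simp: bounded_iff)
    have "\<bar>p x\<bar> \<le> M" "\<bar>q x\<bar> \<le> M" if "0 \<le> x" for x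
      using M[OF that] norm_fst_le[of "fst (y x)" "snd (y x)"] norm_snd_le[of "snd (y x)" "fst (y x)"]
      by (auto simp: p_def q_def)
    then have "bounded (p ` {0..})" "bounded (q ` {0..})"
      by (auto simp: bounded_iff)
    moreover have "continuous_on {0..} p" "continuous_on {0..} q"
      unfolding p_def q_def by (intro continuous_intros y_cont; simp)+
    moreover have "p 0 = - a / 2" "q 0 = a / 2"
      by (simp_all add: p_def q_def y0)
    ultimately show ?thesis using D unfolding half_line_solution_def by blast
  qed
  then show ?thesis using a0 by blast
qed

section \<open>One-sided derivatives, reflection, and pasting at the origin\<close>

lemma has_real_derivative_split_at_0:
  assumes "0 \<le> x \<Longrightarrow> (f has_real_derivative D) (at x within {0..})"
    and "x \<le> 0 \<Longrightarrow> (f has_real_derivative D) (at x within {..0})"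
  shows "(f has_real_derivative D) (at x)"
proof -
  consider "x < 0" | "x = 0" | "0 < x" by linarith
  then show ?thesis
  proof cases
    case 2
    then show ?thesis
      using assms by (simp add: has_field_derivative_iff filterlim_at_split
          at_within_Ici_at_right at_within_Iic_at_left)
  qed (use assms at_within_interior[of x "{0..}"] at_within_interior[of x "{..0}"] in auto)
qed

lemma has_real_derivative_reflect_half_line:
  assumes "(f has_real_derivative D) (at (- x) within {0..})"
  shows "((\<lambda>x. f (- x)) has_real_derivative - D) (at x within {..0})"
proof -
  have "(f \<circ> uminus has_real_derivative D * - 1) (at x within {..0})"
    using assms by (intro DERIV_image_chain) (auto intro!: derivative_eq_intros simp: image_uminus_atMost)
  then show ?thesis by (simp add: o_def)
qed

lemma affine_on_half_line:
  fixes h :: "real \<Rightarrow> real"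
  assumes "continuous_on UNIV h" "\<And>x. 0 < x \<Longrightarrow> (h has_real_derivative k) (at x)" "0 \<le> x"
  shows "h x = h 0 + k * x"
proof (cases "x = 0")
  case False
  have "h x - k * x = h 0 - k * 0"
  proof (rule DERIV_isconst_end[where f = "\<lambda>x. h x - k * x"])
    show "continuous_on {0..x} (\<lambda>x. h x - k * x)"
      by (intro continuous_intros continuous_on_subset[OF assms(1)]) auto
    show "\<And>t. 0 < t \<Longrightarrow> t < x \<Longrightarrow> ((\<lambda>x. h x - k * x) has_real_derivative 0) (at t)"
      by (auto intro!: derivative_eq_intros assms(2))
  qed (use assms False in auto)
  then show ?thesis by simp
qed simp

lemma half_line_derivative:
  fixes h :: "real \<Rightarrow> real"
  assumes "continuous_on UNIV h"
  shows has_real_derivative_right_of_0: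
      "(\<And>x. 0 < x \<Longrightarrow> (h has_real_derivative k) (at x)) \<Longrightarrow> 0 \<le> x
        \<Longrightarrow> (h has_real_derivative k) (at x within {0..})"
    and has_real_derivative_left_of_0:
      "(\<And>x. x < 0 \<Longrightarrow> (h has_real_derivative k) (at x)) \<Longrightarrow> x \<le> 0
        \<Longrightarrow> (h has_real_derivative k) (at x within {..0})"
proof -
  have right: "(h has_real_derivative k) (at x within {0..})"
    if "continuous_on UNIV h" "\<And>x. 0 < x \<Longrightarrow> (h has_real_derivative k) (at x)" "0 \<le> x"
    for h :: "real \<Rightarrow> real" and k x
  proof -
    have "((\<lambda>x. h 0 + k * x) has_real_derivative k) (at x within {0..})"
      by (auto intro!: derivative_eq_intros)
    then show ?thesis
      by (rule has_field_derivative_transform_within[OF _ zero_less_one])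
        (simp_all add: that(3) affine_on_half_line[OF that(1,2), symmetric])
  qed
  show "(h has_real_derivative k) (at x within {0..})"
    if "\<And>x. 0 < x \<Longrightarrow> (h has_real_derivative k) (at x)" "0 \<le> x"
    using right assms that by blast
  show "(h has_real_derivative k) (at x within {..0})"
    if d: "\<And>x. x < 0 \<Longrightarrow> (h has_real_derivative k) (at x)" and x: "x \<le> 0"
  proof -
    \<comment> \<open>The left case is the right case for the reflected function, whose slope is
      \<open>- k\<close>, reflected back.\<close>
    have "((\<lambda>x. h (- x)) has_real_derivative - k) (at (- x) within {0..})"
    proof (rule right)
      show "continuous_on UNIV (\<lambda>x. h (- x))"
        by (intro continuous_on_compose2[OF assms] continuous_intros) auto
      show "((\<lambda>x. h (- x)) has_real_derivative - k) (at x)" if "0 < x" for x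
        using d[of "- x"] that by (simp add: DERIV_mirror)
    qed (use x in simp)
    from has_real_derivative_reflect_half_line[OF this] show ?thesis by simp
  qed
qed

text \<open>A bounded derivative makes \<open>u\<close> Lipschitz, which yields absolute continuity
  and linear growth. Continuity of the derivative leaves no point at which the jump condition has to
  be checked.\<close>

lemma admissible_solution_C1:
  assumes D: "\<And>x. (u has_vector_derivative P x) (at x)"
    and cont: "continuous_on UNIV P" and bdd: "bounded (range P)"
    and eqs: "\<And>x. fst (u x) = h1 x - fst (P x) * snd (P x) - (fst (P x))\<^sup>2 / 2"
      "\<And>x. snd (u x) = h2 x - fst (P x) * snd (P x) - (snd (P x))\<^sup>2 / 2"
  shows "admissible_solution h1 h2 u"
proof -
  obtain B where B: "0 < B" "\<And>x. norm (P x) \<le> B"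
    using bdd by (auto simp: bounded_pos)
  have "B-lipschitz_on UNIV u"
  proof (rule bounded_derivative_imp_lipschitz)
    show "(u has_derivative (\<lambda>h. h *\<^sub>R P x)) (at x)" for x
      using D[of x] by (simp add: has_vector_derivative_def)
    show "onorm (\<lambda>h. h *\<^sub>R P x) \<le> B" for x
      using B by (intro onorm_bound) (auto simp: mult.commute[of B] intro!: mult_left_mono)
  qed (use B in auto)
  then have lip: "norm (u t - u s) \<le> B * \<bar>t - s\<bar>" for s t
    using lipschitz_onD[of B UNIV u t s] by (simp add: dist_norm)
  have "abs_continuous_on a b u" for a b
    unfolding abs_continuous_on_def
  proof (intro allI impI)
    fix \<epsilon> :: real assume "0 < \<epsilon>"
    show "\<exists>\<delta>>0. \<forall>(n::nat) s t.
        (\<forall>i<n. a \<le> s i \<and> s i \<le> t i \<and> t i \<le> b) \<and>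
        disjoint_family_on (\<lambda>i. {s i<..<t i}) {..<n} \<and>
        (\<Sum>i<n. t i - s i) < \<delta> \<longrightarrow>
        (\<Sum>i<n. norm (u (t i) - u (s i))) < \<epsilon>"
    proof (intro exI[of _ "\<epsilon> / B"] conjI allI impI)
      fix n :: nat and s t :: "nat \<Rightarrow> real"
      assume H: "(\<forall>i<n. a \<le> s i \<and> s i \<le> t i \<and> t i \<le> b) \<and>
        disjoint_family_on (\<lambda>i. {s i<..<t i}) {..<n} \<and> (\<Sum>i<n. t i - s i) < \<epsilon> / B"
      have "(\<Sum>i<n. norm (u (t i) - u (s i))) \<le> (\<Sum>i<n. B * (t i - s i))"
        using H lip by (intro sum_mono) (metis abs_of_nonneg diff_ge_0_iff_ge lessThan_iff)
      also have "\<dots> = B * (\<Sum>i<n. t i - s i)"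
        by (simp add: sum_distrib_left)
      also have "\<dots> < \<epsilon>"
        using H B by (simp add: pos_less_divide_eq mult.commute)
      finally show "(\<Sum>i<n. norm (u (t i) - u (s i))) < \<epsilon>" .
    qed (use \<open>0 < \<epsilon>\<close> B in simp)
  qed
  moreover have "solves_at h1 h2 u x" for x
    using D[of x] eqs[of x] unfolding solves_at_def
    by (intro exI[of _ "fst (P x)"] exI[of _ "snd (P x)"]) simp
  moreover have "norm (u x) \<le> (norm (u 0) + B) * (1 + \<bar>x\<bar>)" for x
  proof -
    have "norm (u x) \<le> norm (u 0) + B * \<bar>x\<bar>"
      using lip[of x 0] norm_triangle_sub[of "u x" "u 0"] by simp
    also have "\<dots> \<le> (norm (u 0) + B) * (1 + \<bar>x\<bar>)"
      using B by (simp add: algebra_simps)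
    finally show ?thesis .
  qed
  moreover have "diff_points u = UNIV"
    using D by (auto simp: diff_points_def differentiable_def has_vector_derivative_def)
  moreover have "vderiv u = P"
    using D by (auto intro: vector_derivative_at)
  moreover have "(P \<longlongrightarrow> P y) (at y within S)" for y S
    using cont by (meson UNIV_I continuous_on_def subset_UNIV tendsto_within_subset)
  \<comment> \<open>\<open>P y\<close> is both one-sided limits of the derivative at
    \<open>y\<close>.\<close>
  ultimately show ?thesis
    unfolding admissible_solution_def deriv_continuous_at_def
    by (intro conjI allI exI[of _ "P _"] exI[of _ "norm (u 0) + B"]) (simp_all add: continuous_within)
qed

section \<open>Signs of the slope combinations in the two sectors\<close>

lemma sector_3_pos:
  assumes "(k1, k2) \<in> sector 3"
  shows "0 < k1 + k2" "0 < k2 - k1"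
proof -
  obtain r t where r: "0 < r" "k1 = r * cos t" "k2 = r * sin t" and t: "pi / 2 < t" "t < 3 * pi / 4"
    using assms by (auto simp: sector_def)
  \<comment> \<open>Multiplied by \<open>sqrt 2\<close>, these sines are
    \<open>cos t + sin t\<close> and \<open>sin t - cos t\<close>; in the sector both angles lie
    between \<open>0\<close> and \<open>pi\<close>.\<close>
  have "0 < sin (t + pi / 4)" "0 < sin (t - pi / 4)"
    using t by (auto intro!: sin_gt_zero)
  then have "0 < (cos t + sin t) * (sqrt 2 / 2)" "0 < (sin t - cos t) * (sqrt 2 / 2)"
    by (simp_all add: sin_add sin_diff sin_45 cos_45 algebra_simps)
  then have "0 < cos t + sin t" "0 < sin t - cos t"
    by (simp_all add: zero_less_mult_iff)
  then have "0 < r * (cos t + sin t)" "0 < r * (sin t - cos t)"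
    using r(1) by simp_all
  then show "0 < k1 + k2" "0 < k2 - k1"
    by (simp_all add: r algebra_simps)
qed

text \<open>Reflecting \<open>x\<close> and swapping the negated components maps the system to itself and exchanges
  the two sectors.\<close>

lemma sector_4_imp_sector_3:
  assumes "(k1, k2) \<in> sector 4"
  shows "(- k2, - k1) \<in> sector 3"
proof -
  obtain r t where r: "0 < r" "k1 = r * cos t" "k2 = r * sin t" and t: "3 * pi / 4 < t" "t < pi"
    using assms by (auto simp: sector_def)
  have "3 * pi / 2 - t = pi / 2 - t + pi" by simp
  then have "- k2 = r * cos (3 * pi / 2 - t)" "- k1 = r * sin (3 * pi / 2 - t)"
    using r by (simp_all only: cos_periodic_pi sin_periodic_pi) (simp_all add: cos_diff sin_diff)
  then have "(- k2, - k1) = (r * cos (3 * pi / 2 - t), r * sin (3 * pi / 2 - t)) \<and> 0 < r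
      \<and> (real 3 - 1) * pi / 4 < 3 * pi / 2 - t \<and> 3 * pi / 2 - t < real 3 * pi / 4"
    using r(1) t by simp
  then show ?thesis
    unfolding sector_def by blast
qed

theorem mainTheorem3:
  fixes h1 h2 :: "real \<Rightarrow> real"
    and \<kappa>10 \<kappa>11 \<kappa>20 \<kappa>21 :: real
  assumes "continuous_on UNIV h1" and "continuous_on UNIV h2"
    and "\<And>x. x < 0 \<Longrightarrow> (h1 has_real_derivative \<kappa>10) (at x)"
    and "\<And>x. x > 0 \<Longrightarrow> (h1 has_real_derivative \<kappa>11) (at x)"
    and "\<And>x. x < 0 \<Longrightarrow> (h2 has_real_derivative \<kappa>20) (at x)"
    and "\<And>x. x > 0 \<Longrightarrow> (h2 has_real_derivative \<kappa>21) (at x)"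
    and "(\<kappa>10, \<kappa>20) \<in> sector 4"
    and "(\<kappa>11, \<kappa>21) \<in> sector 3"
  shows "infinite {u :: real \<Rightarrow> real \<times> real. admissible_solution h1 h2 u}"
proof -
  obtain a0 where a0: "0 < a0"
    and right: "\<And>a. 0 < a \<Longrightarrow> a < a0 \<Longrightarrow> \<exists>p q. half_line_solution \<kappa>11 \<kappa>21 a p q"
    using half_line_solution_exists[OF sector_3_pos[OF assms(8)]] by blast
  \<comment> \<open>The negative half line is treated through its reflection, whose slopes are
    \<open>- \<kappa>20\<close> and \<open>- \<kappa>10\<close>.\<close>
  obtain a1 where a1: "0 < a1"
    and left: "\<And>a. 0 < a \<Longrightarrow> a < a1 \<Longrightarrow> \<exists>p q. half_line_solution (- \<kappa>20) (- \<kappa>10) a p q"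
    using half_line_solution_exists[OF sector_3_pos[OF sector_4_imp_sector_3[OF assms(7)]]] by blast
  \<comment> \<open>The derivative at \<open>0\<close> is recorded because it will tell the
    solutions apart.\<close>
  have "\<exists>u. admissible_solution h1 h2 u \<and> (u has_vector_derivative (- a / 2, a / 2)) (at 0)"
    if a: "0 < a" "a < min a0 a1" for a
  proof -
    obtain p1 q1 where init1: "p1 0 = - a / 2" "q1 0 = a / 2"
      and bdd1: "bounded (p1 ` {0..})" "bounded (q1 ` {0..})"
      and cont1: "continuous_on {0..} p1" "continuous_on {0..} q1"
      and D1: "\<And>x. 0 \<le> x \<Longrightarrow> ((\<lambda>x. p1 x * q1 x + (p1 x)\<^sup>2 / 2) has_real_derivative \<kappa>11 - p1 x) (at x within {0..})"
        "\<And>x. 0 \<le> x \<Longrightarrow> ((\<lambda>x. p1 x * q1 x + (q1 x)\<^sup>2 / 2) has_real_derivative \<kappa>21 - q1 x) (at x within {0..})"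
      using right[of a] a unfolding half_line_solution_def by auto
    obtain p2 q2 where init2: "p2 0 = - a / 2" "q2 0 = a / 2"
      and bdd2: "bounded (p2 ` {0..})" "bounded (q2 ` {0..})"
      and cont2: "continuous_on {0..} p2" "continuous_on {0..} q2"
      and D2: "\<And>x. 0 \<le> x \<Longrightarrow> ((\<lambda>x. p2 x * q2 x + (p2 x)\<^sup>2 / 2) has_real_derivative - \<kappa>20 - p2 x) (at x within {0..})"
        "\<And>x. 0 \<le> x \<Longrightarrow> ((\<lambda>x. p2 x * q2 x + (q2 x)\<^sup>2 / 2) has_real_derivative - \<kappa>10 - q2 x) (at x within {0..})"
      using left[of a] a unfolding half_line_solution_def by auto
    \<comment> \<open>The two branches agree at \<open>0\<close>: the reflection sends
      \<open>(- a / 2, a / 2)\<close> to itself, so \<open>p\<close> and \<open>q\<close> have no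
      jump there.\<close>
    define p q where "p x = (if 0 \<le> x then p1 x else - q2 (- x))"
      and "q x = (if 0 \<le> x then q1 x else - p2 (- x))" for x
    have eq_right: "p x = p1 x" "q x = q1 x" if "0 \<le> x" for x
      using that by (simp_all add: p_def q_def)
    have eq_left: "p x = - q2 (- x)" "q x = - p2 (- x)" if "x \<le> 0" for x
      using that init1 init2 by (cases "x = 0"; simp add: p_def q_def)+
    have D_right: "((\<lambda>x. p x * q x + (p x)\<^sup>2 / 2) has_real_derivative \<kappa>11 - p x) (at x within {0..})"
      "((\<lambda>x. p x * q x + (q x)\<^sup>2 / 2) has_real_derivative \<kappa>21 - q x) (at x within {0..})" if "0 \<le> x" for x
      using has_field_derivative_transform_within[OF D1(1)[OF that] zero_less_one]
        has_field_derivative_transform_within[OF D1(2)[OF that] zero_less_one] that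
      by (auto simp: eq_right)
    have D_left: "((\<lambda>x. p x * q x + (p x)\<^sup>2 / 2) has_real_derivative \<kappa>10 - p x) (at x within {..0})"
      "((\<lambda>x. p x * q x + (q x)\<^sup>2 / 2) has_real_derivative \<kappa>20 - q x) (at x within {..0})" if "x \<le> 0" for x
    proof -
      note D = has_real_derivative_reflect_half_line[OF D2(2)[of "- x"]]
        has_real_derivative_reflect_half_line[OF D2(1)[of "- x"]]
      show "((\<lambda>x. p x * q x + (p x)\<^sup>2 / 2) has_real_derivative \<kappa>10 - p x) (at x within {..0})"
        using that by (intro has_field_derivative_transform_within[OF DERIV_cong[OF D(1)] zero_less_one])
          (simp_all add: eq_left)
      show "((\<lambda>x. p x * q x + (q x)\<^sup>2 / 2) has_real_derivative \<kappa>20 - q x) (at x within {..0})"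
        using that by (intro has_field_derivative_transform_within[OF DERIV_cong[OF D(2)] zero_less_one])
          (simp_all add: eq_left)
    qed
    have cont: "continuous_on UNIV p" "continuous_on UNIV q"
    proof -
      have un: "(UNIV :: real set) = {..0} \<union> {0..}" by auto
      have refl_cont: "continuous_on {..0} (\<lambda>x. - p2 (- x))" "continuous_on {..0} (\<lambda>x. - q2 (- x))"
        by (auto intro!: continuous_intros continuous_on_compose2[OF cont2(1)] continuous_on_compose2[OF cont2(2)])
      then have "continuous_on {..0} p" "continuous_on {..0} q"
        using eq_left by (auto intro: continuous_on_eq[OF refl_cont(2)] continuous_on_eq[OF refl_cont(1)])
      moreover have "continuous_on {0..} p" "continuous_on {0..} q"
        using eq_right by (auto intro: continuous_on_eq[OF cont1(1)] continuous_on_eq[OF cont1(2)])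
      ultimately show "continuous_on UNIV p" "continuous_on UNIV q"
        unfolding un by (auto intro: continuous_on_closed_Un)
    qed
    have sub: "range p \<subseteq> p1 ` {0..} \<union> uminus ` q2 ` {0..}" "range q \<subseteq> q1 ` {0..} \<union> uminus ` p2 ` {0..}"
      by (auto simp: p_def q_def image_image)
    then have bdd: "bounded (range p)" "bounded (range q)"
      using bdd1 bdd2 bounded_subset[OF _ sub(1)] bounded_subset[OF _ sub(2)] by simp_all
    \<comment> \<open>\<open>u\<close> satisfies the system with \<open>(p, q)\<close> in place of
      its derivative by construction; what remains is that its derivative is \<open>(p, q)\<close>,
      also at \<open>0\<close>, where the slopes of \<open>h1\<close> and \<open>h2\<close> may
      jump.\<close>
    define u where "u x = (h1 x - (p x * q x + (p x)\<^sup>2 / 2), h2 x - (p x * q x + (q x)\<^sup>2 / 2))" for x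
    have "((\<lambda>x. h1 x - (p x * q x + (p x)\<^sup>2 / 2)) has_real_derivative p x) (at x)" for x
      by (rule has_real_derivative_split_at_0)
        (use DERIV_diff[OF has_real_derivative_right_of_0[OF assms(1,4)] D_right(1)]
          DERIV_diff[OF has_real_derivative_left_of_0[OF assms(1,3)] D_left(1)] in auto)
    moreover have "((\<lambda>x. h2 x - (p x * q x + (q x)\<^sup>2 / 2)) has_real_derivative q x) (at x)" for x
      by (rule has_real_derivative_split_at_0)
        (use DERIV_diff[OF has_real_derivative_right_of_0[OF assms(2,6)] D_right(2)]
          DERIV_diff[OF has_real_derivative_left_of_0[OF assms(2,5)] D_left(2)] in auto)
    ultimately have u: "(u has_vector_derivative (p x, q x)) (at x)" for x
      unfolding u_def by (intro has_vector_derivative_Pair)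
        (simp_all add: has_real_derivative_iff_has_vector_derivative)
    have "admissible_solution h1 h2 u"
    proof (rule admissible_solution_C1[OF u])
      show "continuous_on UNIV (\<lambda>x. (p x, q x))"
        using cont by (intro continuous_intros)
      show "bounded (range (\<lambda>x. (p x, q x)))"
        by (rule bounded_subset[OF bounded_Times[OF bdd]]) auto
    qed (simp_all add: u_def)
    moreover have "(u has_vector_derivative (- a / 2, a / 2)) (at 0)"
      using u[of 0] by (simp add: p_def q_def init1)
    ultimately show ?thesis by blast
  qed
  then obtain u where u: "\<And>a. a \<in> {0<..<min a0 a1} \<Longrightarrow> admissible_solution h1 h2 (u a)"
    "\<And>a. a \<in> {0<..<min a0 a1} \<Longrightarrow> (u a has_vector_derivative (- a / 2, a / 2)) (at 0)"
    by (metis greaterThanLessThan_iff)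
  \<comment> \<open>Equal solutions have equal derivatives at \<open>0\<close>, so the parameter can
    be recovered.\<close>
  have "inj_on u {0<..<min a0 a1}"
  proof (rule inj_onI)
    fix a b assume "a \<in> {0<..<min a0 a1}" "b \<in> {0<..<min a0 a1}" "u a = u b"
    then show "a = b"
      using vector_derivative_unique_at[OF u(2)[of a], of "(- b / 2, b / 2)"] u(2)[of b] by auto
  qed
  moreover have "infinite {0<..<min a0 a1}"
    using a0 a1 by simp
  ultimately have "infinite (u ` {0<..<min a0 a1})"
    using finite_imageD by blast
  then show ?thesis
    using u(1) by (elim infinite_super[rotated]) auto
qed

end
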